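(* Let $S=\left\{p_\theta(x)=\frac{b}{a}\left(\frac{x}{a}\right)^{b-1}e^{-\left(\frac{x}{a}\right)^b} : \theta=(a,b)\in\mathbb{R}_+\times\mathbb{R}_+,\ x\in\mathbb{R}_+\right\}$ be the Weibull statistical model, where $p_\theta$ is the Weibull density. The coordinate system $\theta=(\theta_1,\theta_2)=(a,b)$ on the Weibull manifold $S$ does not admit dual coordinates or a potential function.
   Context: $\mathbb{R}_+$ denotes the positive reals. The manifold $S$ carries the Fisher information metric $g_{ij}(\theta)=-\mathbb{E}\left[\partial_{\theta_i}\partial_{\theta_j}\ell(x,\theta)\right]$, where $\ell(x,\theta)=\log p_\theta(x)$, $\partial_{\theta_i}=\frac{\partial}{\partial\theta_i}$ and $\mathbb{E}$ is expectation with respect to $p_\theta$. A coordinate system $\eta=(\eta_1,\eta_2)$ is dual to $\theta$ if the basis vectors are biorthogonal: $\langle\partial_{\theta_i},\partial_{\eta_j}\rangle=\delta_i^j$ with respect to this metric. A potential function for the coordinate system $\theta$ is a function $\Phi(\theta)$ with $g_{ij}=\partial_{\theta_i}\partial_{\theta_j}\Phi(\theta)$ for all $i,j$. *)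

theory Defs
  imports "HOL-Analysis.Analysis"
begin

definition partial_deriv :: "'n::finite \<Rightarrow> (real ^ 'n \<Rightarrow> 'b::real_normed_vector) \<Rightarrow> real ^ 'n \<Rightarrow> 'b" where
  "partial_deriv i f \<theta> = vector_derivative (\<lambda>t. f (\<theta> + t *\<^sub>R axis i 1)) (at 0)"

text \<open>A statistical model is a family \<open>p\<close> of densities on the real line (with respect to Lebesgue
  measure) whose parameter ranges over an open set \<open>\<Theta>\<close>.  The manifold is identified with \<open>\<Theta>\<close> through
  its global coordinate system \<open>\<theta>\<close>; tangent vectors are given by their components in the basis
  of the \<open>\<partial>/\<partial>\<theta>\<^sub>i\<close>, so that \<open>\<partial>/\<partial>\<theta>\<^sub>i\<close> is \<open>axis i 1\<close>.\<close>

definition model_expectation :: "('p \<Rightarrow> real \<Rightarrow> real) \<Rightarrow> 'p \<Rightarrow> (real \<Rightarrow> real) \<Rightarrow> real" where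
  "model_expectation p \<theta> f = (\<integral>x. f x \<partial>density lborel (\<lambda>x. ennreal (p \<theta> x)))"

definition log_likelihood :: "('p \<Rightarrow> real \<Rightarrow> real) \<Rightarrow> real \<Rightarrow> 'p \<Rightarrow> real" where
  "log_likelihood p x \<theta> = ln (p \<theta> x)"

definition fisher_metric :: "(real ^ 'n::finite \<Rightarrow> real \<Rightarrow> real) \<Rightarrow> real ^ 'n \<Rightarrow> real ^ 'n ^ 'n" where
  "fisher_metric p \<theta> =
     (\<chi> i j. - model_expectation p \<theta>
                 (\<lambda>x. partial_deriv i (partial_deriv j (log_likelihood p x)) \<theta>))"

definition metric_inner :: "real ^ 'n ^ 'n \<Rightarrow> real ^ 'n::finite \<Rightarrow> real ^ 'n \<Rightarrow> real" where
  "metric_inner G u v = (\<Sum>k\<in>UNIV. \<Sum>l\<in>UNIV. G $ k $ l * u $ k * v $ l)"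

text \<open>Only differentiability of both coordinate changes is required, so that smooth coordinate
  systems are included.\<close>

definition coordinate_system_on :: "(real ^ 'n::finite) set \<Rightarrow> (real ^ 'n \<Rightarrow> real ^ 'n) \<Rightarrow> bool" where
  "coordinate_system_on \<Theta> \<eta> \<longleftrightarrow>
     inj_on \<eta> \<Theta> \<and> open (\<eta> ` \<Theta>) \<and> \<eta> differentiable_on \<Theta> \<and>
     the_inv_into \<Theta> \<eta> differentiable_on \<eta> ` \<Theta>"

text \<open>By the chain rule, \<open>\<partial>/\<partial>\<eta>\<^sub>j = (\<Sum>k. \<partial>\<theta>\<^sub>k/\<partial>\<eta>\<^sub>j \<partial>/\<partial>\<theta>\<^sub>k)\<close>, where \<open>\<theta>\<close> as a function
  of \<open>\<eta>\<close> is the inverse of \<open>\<eta>\<close>.\<close>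

definition coordinate_vector ::
    "(real ^ 'n::finite) set \<Rightarrow> (real ^ 'n \<Rightarrow> real ^ 'n) \<Rightarrow> 'n \<Rightarrow> real ^ 'n \<Rightarrow> real ^ 'n" where
  "coordinate_vector \<Theta> \<eta> j \<theta> = partial_deriv j (the_inv_into \<Theta> \<eta>) (\<eta> \<theta>)"

definition dual_coordinates ::
    "(real ^ 'n::finite) set \<Rightarrow> (real ^ 'n \<Rightarrow> real ^ 'n ^ 'n) \<Rightarrow> (real ^ 'n \<Rightarrow> real ^ 'n) \<Rightarrow> bool" where
  "dual_coordinates \<Theta> g \<eta> \<longleftrightarrow>
     coordinate_system_on \<Theta> \<eta> \<and>
     (\<forall>\<theta>\<in>\<Theta>. \<forall>i j. metric_inner (g \<theta>) (axis i 1) (coordinate_vector \<Theta> \<eta> j \<theta>)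
                    = (if i = j then 1 else 0))"

definition potential_function ::
    "(real ^ 'n::finite) set \<Rightarrow> (real ^ 'n \<Rightarrow> real ^ 'n ^ 'n) \<Rightarrow> (real ^ 'n \<Rightarrow> real) \<Rightarrow> bool" where
  "potential_function \<Theta> g \<Phi> \<longleftrightarrow>
     \<Phi> differentiable_on \<Theta> \<and> (\<forall>j. partial_deriv j \<Phi> differentiable_on \<Theta>) \<and>
     (\<forall>\<theta>\<in>\<Theta>. \<forall>i j. g \<theta> $ i $ j = partial_deriv i (partial_deriv j \<Phi>) \<theta>)"

definition weibull_params :: "(real ^ 2) set" where
  "weibull_params = {\<theta>. 0 < \<theta> $ 1 \<and> 0 < \<theta> $ 2}"

text \<open>The density is extended by zero to the nonpositive reals.\<close>

definition weibull_density :: "real ^ 2 \<Rightarrow> real \<Rightarrow> real" where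
  "weibull_density \<theta> x =
     (let a = \<theta> $ 1; b = \<theta> $ 2
      in if 0 < x then b / a * (x / a) powr (b - 1) * exp (- ((x / a) powr b)) else 0)"

end

theory Submission imports Defs begin

text \<open>The Fisher metric has \<open>g\<^sub>1\<^sub>1 = b\<^sup>2/a\<^sup>2\<close> and, because \<open>v = (x/a)\<^sup>b\<close> is standard exponential,
  \<open>g\<^sub>1\<^sub>2 = K/a\<close> with a constant \<open>K\<close>.  Dual coordinates \<open>\<eta>\<close> have Jacobian \<open>g\<close>, and a potential \<open>\<Phi>\<close>
  has Hessian \<open>g\<close>; so either \<open>\<eta>\<^sub>1\<close> or \<open>\<partial>\<Phi>/\<partial>a\<close> would be a primitive of \<open>g\<^sub>1\<^sub>1 da + g\<^sub>1\<^sub>2 db\<close>.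
  But this form is not closed.\<close>

section \<open>Partial derivatives and restriction to coordinate lines\<close>

lemma has_derivative_along_axis:
  fixes f :: "real ^ 'n::finite \<Rightarrow> 'b::real_normed_vector"
  assumes "(f has_derivative f') (at (\<theta> + s *\<^sub>R axis i 1))"
  shows "((\<lambda>t. f (\<theta> + t *\<^sub>R axis i 1)) has_vector_derivative f' (axis i 1)) (at s)"
proof -
  have "((\<lambda>t. \<theta> + t *\<^sub>R axis i 1) has_vector_derivative axis i 1) (at s)"
    by (auto intro!: derivative_eq_intros)
  from vector_derivative_diff_chain_within[OF this has_derivative_at_withinI[OF assms]]
  show ?thesis
    by (simp add: o_def)
qed

lemma partial_deriv_has_derivative:
  assumes "(f has_derivative f') (at \<theta>)"
  shows "partial_deriv i f \<theta> = f' (axis i 1)"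
  using has_derivative_along_axis[where s = 0, of f f' \<theta> i] assms
  unfolding partial_deriv_def by (simp add: vector_derivative_at)

lemma partial_deriv_cong_open:
  fixes f g :: "real ^ 'n::finite \<Rightarrow> 'b::real_normed_vector"
  assumes "open S" "\<theta> \<in> S" "\<And>\<theta>. \<theta> \<in> S \<Longrightarrow> f \<theta> = g \<theta>"
  shows "partial_deriv i f \<theta> = partial_deriv i g \<theta>"
proof -
  have "((\<lambda>t. \<theta> + t *\<^sub>R axis i 1) \<longlongrightarrow> \<theta> + 0 *\<^sub>R axis i (1::real)) (nhds 0)"
    by (intro tendsto_intros filterlim_ident)
  then have "\<forall>\<^sub>F t in nhds 0. \<theta> + t *\<^sub>R axis i 1 \<in> S"
    using assms(1,2) by (simp add: topological_tendstoD)
  then have "\<forall>\<^sub>F t in nhds 0. f (\<theta> + t *\<^sub>R axis i 1) = g (\<theta> + t *\<^sub>R axis i 1)"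
    by eventually_elim (use assms(3) in auto)
  then show ?thesis
    unfolding partial_deriv_def by (intro vector_derivative_cong_eq) auto
qed

section \<open>Dual coordinates and their Jacobian\<close>

lemma metric_inner_axis: "metric_inner G (axis i 1) v = (G *v v) $ i"
proof -
  have "(\<Sum>l\<in>UNIV. G $ k $ l * axis i 1 $ k * v $ l) = (if k = i then (G *v v) $ i else 0)" for k
    by (simp add: axis_def matrix_vector_mult_def)
  then show ?thesis
    by (simp add: metric_inner_def)
qed

text \<open>Let \<open>\<psi>'\<close> and \<open>\<eta>'\<close> be the derivatives of the inverse
  chart and of \<open>\<eta>\<close>. Biorthogonality says that \<open>g \<theta>\<close> composed
  with \<open>\<psi>'\<close> is the identity, and the chain rule gives
  \<open>\<psi>' (\<eta>' v) = v\<close>. Hence \<open>\<eta>' v = g \<theta> *v \<psi>' (\<eta>' v)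
  = g \<theta> *v v\<close>.\<close>

lemma dual_coordinates_partial_deriv:
  assumes "dual_coordinates \<Theta> g \<eta>" "open \<Theta>" "\<theta> \<in> \<Theta>"
  shows "partial_deriv j (\<lambda>\<theta>. \<eta> \<theta> $ i) \<theta> = g \<theta> $ i $ j"
proof -
  let ?\<psi> = "the_inv_into \<Theta> \<eta>"
  have inj: "inj_on \<eta> \<Theta>" and op: "open (\<eta> ` \<Theta>)"
    and "\<eta> differentiable_on \<Theta>" "?\<psi> differentiable_on \<eta> ` \<Theta>"
    and dual: "\<And>i j. metric_inner (g \<theta>) (axis i 1) (coordinate_vector \<Theta> \<eta> j \<theta>) = (if i = j then 1 else 0)"
    using assms unfolding dual_coordinates_def coordinate_system_on_def by auto
  then obtain \<eta>' \<psi>' where \<eta>': "(\<eta> has_derivative \<eta>') (at \<theta>)" and \<psi>': "(?\<psi> has_derivative \<psi>') (at (\<eta> \<theta>))"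
    using assms(2,3) op
    by (metis differentiable_def differentiable_on_eq_differentiable_at image_eqI)
  have "(?\<psi> \<circ> \<eta> has_derivative \<psi>' \<circ> \<eta>') (at \<theta>)"
    by (rule diff_chain_at[OF \<eta>' \<psi>'])
  moreover have "(?\<psi> \<circ> \<eta> has_derivative id) (at \<theta>)"
    by (rule has_derivative_transform_within_open[OF has_derivative_id assms(2,3)])
       (simp add: the_inv_into_f_f[OF inj])
  ultimately have inv: "\<psi>' (\<eta>' v) = v" for v
    using has_derivative_unique by (metis comp_apply id_apply)
  interpret \<psi>': linear \<psi>'
    using \<psi>' by (rule has_derivative_linear)
  have id_on_axis: "g \<theta> *v \<psi>' (axis k 1) = axis k 1" for k
    using dual[of _ k] partial_deriv_has_derivative[OF \<psi>', of k]
    unfolding metric_inner_axis coordinate_vector_def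
    by (auto simp: vec_eq_iff axis_def)
  have "(*v) (g \<theta>) \<circ> \<psi>' = id"
  proof (rule linear_eq_stdbasis)
    show "linear ((*v) (g \<theta>) \<circ> \<psi>')"
      by (intro linear_compose \<psi>'.linear_axioms matrix_vector_mul_linear)
    show "((*v) (g \<theta>) \<circ> \<psi>') b = id b" if "b \<in> Basis" for b
      using that id_on_axis by (auto simp: Basis_vec_def)
  qed (rule linear_id)
  then have "\<eta>' v = g \<theta> *v v" for v
    by (metis comp_apply id_apply inv)
  moreover have "((\<lambda>\<theta>. \<eta> \<theta> $ i) has_derivative (\<lambda>v. \<eta>' v $ i)) (at \<theta>)"
    using bounded_linear.has_derivative[OF bounded_linear_vec_nth \<eta>'] .
  ultimately show ?thesis
    by (simp add: partial_deriv_has_derivative matrix_vector_mult_basis column_def)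
qed

section \<open>Non-exactness of the form on the parameter quadrant\<close>

lemma open_weibull_params: "open weibull_params"
  unfolding weibull_params_def
  by (intro open_Collect_conj open_Collect_less continuous_intros)

text \<open>\<open>partial_deriv\<close> is a meaningful value only where a derivative exists.
  Differentiability provides it at every parameter \<open>s\<close> of the line, so that increments
  of \<open>F\<close> along whole segments can be computed.\<close>

lemma has_vector_derivative_partial_deriv:
  assumes "F differentiable_on S" "open S" "\<theta> + s *\<^sub>R axis i 1 \<in> S"
  shows "((\<lambda>t. F (\<theta> + t *\<^sub>R axis i 1)) has_vector_derivative
           partial_deriv i F (\<theta> + s *\<^sub>R axis i 1)) (at s)"
proof -
  obtain F' where F': "(F has_derivative F') (at (\<theta> + s *\<^sub>R axis i 1))"
    using assms by (metis differentiable_def differentiable_on_eq_differentiable_at)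
  show ?thesis
    using has_derivative_along_axis[OF F'] partial_deriv_has_derivative[OF F'] by simp
qed

text \<open>Comparing the integrals of \<open>b\<^sup>2/a\<^sup>2 da + K/a db\<close> along the two
  monotone boundary paths of \<open>[1,2] \<times> [1,b]\<close> gives \<open>K = -3\<close> for \<open>b = 2\<close> and \<open>K = -4\<close> for
  \<open>b = 3\<close>.\<close>

lemma no_weibull_primitive:
  fixes F :: "real ^ 2 \<Rightarrow> real"
  assumes diff: "F differentiable_on weibull_params"
    and d1: "\<And>\<theta>. \<theta> \<in> weibull_params \<Longrightarrow> partial_deriv 1 F \<theta> = (\<theta> $ 2)\<^sup>2 / (\<theta> $ 1)\<^sup>2"
    and d2: "\<And>\<theta>. \<theta> \<in> weibull_params \<Longrightarrow> partial_deriv 2 F \<theta> = K / \<theta> $ 1"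
  shows False
proof -
  define f where "f a b = F (axis 1 a + axis 2 b)" for a b
  have lines: "axis 2 b + a *\<^sub>R axis 1 1 = axis 1 a + (axis 2 b :: real ^ 2)"
    "axis 1 a + b *\<^sub>R axis 2 1 = axis 1 a + (axis 2 b :: real ^ 2)" for a b :: real
    by (simp_all add: vec_eq_iff axis_def)
  have params: "axis 1 a + axis 2 b \<in> weibull_params" if "0 < a" "0 < b" for a b
    using that by (simp add: weibull_params_def axis_def)
  have f1: "((\<lambda>t. f t b) has_real_derivative b\<^sup>2 / a\<^sup>2) (at a within A)" if "0 < a" "0 < b" for a b A
    using has_vector_derivative_partial_deriv[OF diff open_weibull_params, of "axis 2 b" a 1]
      params[OF that] d1[OF params[OF that]] unfolding lines f_def
    by (simp add: has_real_derivative_iff_has_vector_derivative has_vector_derivative_at_within axis_def)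
  \<comment> \<open>A primitive in \<open>t\<close> of \<open>b\<^sup>2 / t\<^sup>2\<close> is
    \<open>- b\<^sup>2 / t\<close>, so this sum is constant in \<open>t\<close>.\<close>
  have "((\<lambda>t. f t b + b\<^sup>2 / t) has_real_derivative 0) (at a within {1..2})"
    if "0 < b" "a \<in> {1..2}" for a b
    using that by (auto intro!: derivative_eq_intros f1 simp: power2_eq_square)
  from has_field_derivative_zero_constant[OF convex_closed_interval this]
  have "\<exists>c. \<forall>a\<in>{1..2}. f a b + b\<^sup>2 / a = c" if "0 < b" for b
    using that by auto
  then have "f 1 b + b\<^sup>2 = f 2 b + b\<^sup>2 / 2" if "0 < b" for b
    using that by force
  \<comment> \<open>One rectangle only determines \<open>K\<close>; the second height
    \<open>b = 3\<close> is what yields a contradiction.\<close>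
  from this[of 1] this[of 2] this[of 3]
  have h: "f 2 1 = f 1 1 + 1 / 2" "f 2 2 = f 1 2 + 2" "f 2 3 = f 1 3 + 9 / 2"
    by (simp_all add: field_simps)
  have f2: "((\<lambda>t. f a t) has_real_derivative K / a) (at b within A)" if "0 < a" "0 < b" for a b A
    using has_vector_derivative_partial_deriv[OF diff open_weibull_params, of "axis 1 a" b 2]
      params[OF that] d2[OF params[OF that]] unfolding lines f_def
    by (simp add: has_real_derivative_iff_has_vector_derivative has_vector_derivative_at_within axis_def)
  have "((\<lambda>t. f a t - K / a * t) has_real_derivative 0) (at b within {1..3})"
    if "0 < a" "b \<in> {1..3}" for a b
    using that by (auto intro!: derivative_eq_intros f2)
  from has_field_derivative_zero_constant[OF convex_closed_interval this]
  have "\<exists>c. \<forall>b\<in>{1..3}. f a b - K / a * b = c" if "0 < a" for a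
    using that by auto
  then have "f a 2 - K / a * 2 = f a 1 - K / a" "f a 3 - K / a * 3 = f a 1 - K / a" if "0 < a" for a
    using that by force+
  \<comment> \<open>The vertical increments are \<open>K\<close> and \<open>2 * K\<close> at
    \<open>a = 1\<close>, but \<open>K / 2\<close> and \<open>K\<close> at \<open>a = 2\<close>.
    With \<open>h\<close> this gives \<open>K / 2 = K + 3 / 2\<close> and
    \<open>K = 2 * K + 4\<close>.\<close>
  from this[of 1] this[of 2] h show False
    by (simp add: field_simps)
qed

section \<open>Expectations as integrals against the exponential law\<close>

text \<open>Substitute \<open>v = (x/a)\<^sup>b\<close>: the density is \<open>exp (- v)\<close>
  times the derivative of \<open>v\<close>. The identity also covers divergent integrals, so the
  logarithmic integrand of the mixed entries needs no convergence proof.\<close>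

lemma weibull_expectation:
  fixes h :: "real \<Rightarrow> real"
  assumes \<theta>: "\<theta> \<in> weibull_params" and [measurable]: "h \<in> borel_measurable borel"
  shows "model_expectation weibull_density \<theta>
           (\<lambda>x. if 0 < x then h ((x / \<theta> $ 1) powr \<theta> $ 2) else 0) =
         (LINT v:{0<..}|lebesgue. exp (- v) * h v)"
proof -
  define a b where "a = \<theta> $ 1" and "b = \<theta> $ 2"
  have [simp]: "0 < a" "0 < b" "a \<noteq> 0" "b \<noteq> 0" "\<bar>a\<bar> = a"
    using \<theta> by (auto simp: weibull_params_def a_def b_def)
  let ?u = "\<lambda>x. (x / a) powr b" and ?u' = "\<lambda>x. b / a * (x / a) powr (b - 1)"
  let ?f = "\<lambda>v. exp (- v) * h v"
  have dens: "weibull_density \<theta> x = indicator {0<..} x * (?u' x * exp (- ?u x))" for x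
    by (simp add: weibull_density_def a_def b_def indicator_def Let_def)
  have [measurable]: "weibull_density \<theta> \<in> borel_measurable borel"
    unfolding dens[abs_def] by measurable
  have "model_expectation weibull_density \<theta> (\<lambda>x. if 0 < x then h (?u x) else 0) =
        (LINT x|lborel. weibull_density \<theta> x * (if 0 < x then h (?u x) else 0))"
    unfolding model_expectation_def
    by (subst integral_density) (auto simp: dens indicator_def less_imp_le intro!: AE_I2)
  \<comment> \<open>\<open>?u'\<close> is positive on the half-line; the absolute value is inserted
    to match the change of variables.\<close>
  also have "\<dots> = (LINT x|lborel. indicator {0<..} x *\<^sub>R (\<bar>?u' x\<bar> * ?f (?u x)))"
    by (intro Bochner_Integration.integral_cong) (auto simp: dens indicator_def abs_mult abs_of_pos)
  also have "\<dots> = (LINT x:{0<..}|lebesgue. \<bar>?u' x\<bar> * ?f (?u x))"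
    unfolding set_lebesgue_integral_def by (subst integral_completion) auto
  also have "\<dots> = (LINT v:{0<..}|lebesgue. ?f v)"
  proof -
    have deriv: "(?u has_real_derivative ?u' x) (at x within {0<..})" if "x \<in> {0<..}" for x
      using that by (auto intro!: derivative_eq_intros simp: powr_diff)
    have inj: "inj_on ?u {0<..}"
      by (rule inj_on_inverseI[of _ "\<lambda>v. a * v powr (1 / b)"]) (auto simp: powr_powr)
    have "v \<in> ?u ` {0<..}" if "0 < v" for v
      using that by (intro image_eqI[of _ _ "a * v powr (1 / b)"]) (auto simp: powr_powr)
    then have img: "?u ` {0<..} = {0<..}"
      by auto
    \<comment> \<open>This is an equivalence: either side is absolutely integrable with a given
      integral iff the other is. It therefore transfers non-integrability too, where both integrals
      take the default value 0.\<close>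
    note cov = has_absolute_integral_change_of_variables_1'[OF _ deriv inj, of ?f, unfolded img]
    show ?thesis
    proof (cases "?f absolutely_integrable_on {0<..}")
      case True
      then show ?thesis
        using cov[of "integral {0<..} ?f"] by (simp add: set_lebesgue_integral_eq_integral)
    next
      case False
      then have not_integrable: "\<not> (\<lambda>x. \<bar>?u' x\<bar> * ?f (?u x)) absolutely_integrable_on {0<..}"
        using cov by auto
      have zero: "(LINT x:{0<..}|lebesgue. k x) = 0"
        if "\<not> k absolutely_integrable_on {0<..}" for k :: "real \<Rightarrow> real"
        using that unfolding set_lebesgue_integral_def set_integrable_def
        by (rule not_integrable_integral_eq)
      show ?thesis
        unfolding zero[OF not_integrable] zero[OF False] ..
    qed
  qed
  finally show ?thesis
    unfolding a_def b_def .
qed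

text \<open>The moments of the exponential law are Gamma values, \<open>fact n\<close>; both moments
  used, \<open>n = 0\<close> and \<open>n = 1\<close>, equal 1.\<close>

lemma exponential_integral_affine:
  fixes c d :: real
  shows "(LINT v:{0<..}|lebesgue. exp (- v) * (c + d * v)) = c + d"
proof -
  have mom: "((\<lambda>v::real. v ^ n * exp (- v)) has_integral fact n) {0<..}" for n
  proof -
    have "((\<lambda>t::real. t powr (real (Suc n) - 1) / exp t) has_integral fact n) {0..}"
      using Gamma_integral_real[of "real (Suc n)"] Gamma_fact[of n, where 'a = real]
      by (simp add: add.commute)
    \<comment> \<open>The endpoint is dropped because \<open>0 powr 0 = 0\<close> while
      \<open>0 ^ 0 = 1\<close>; on the open half-line \<open>powr\<close> and the natural power
      agree.\<close>
    then have "((\<lambda>t::real. t powr (real (Suc n) - 1) / exp t) has_integral fact n) {0<..}"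
    proof (rule iffD1[OF has_integral_spike_set_eq, rotated 2])
      show "negligible {x \<in> {0..} - {0<..}. x powr (real (Suc n) - 1) / exp x \<noteq> 0}"
        by (rule negligible_subset[OF negligible_sing[of 0]]) auto
      show "negligible {x \<in> {0<..} - {0..}. x powr (real (Suc n) - 1) / exp x \<noteq> 0}"
        by (rule negligible_subset[OF negligible_empty]) auto
    qed
    then show ?thesis
      by (rule has_integral_eq[rotated]) (auto simp: powr_realpow exp_minus divide_inverse)
  qed
  have abs: "(\<lambda>v::real. v ^ n * exp (- v)) absolutely_integrable_on {0<..}" for n
    using mom[of n] by (intro nonnegative_absolutely_integrable_1) auto
  have "((\<lambda>v. c * (v ^ 0 * exp (- v)) + d * (v ^ 1 * exp (- v))) has_integral (c * fact 0 + d * fact 1)) {0<..}"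
    by (intro has_integral_add has_integral_mult_right mom)
  moreover have "(\<lambda>v. c * (v ^ 0 * exp (- v)) + d * (v ^ 1 * exp (- v))) absolutely_integrable_on {0<..}"
    by (intro set_integral_add(1) set_integrable_mult_right abs)
  ultimately show ?thesis
    by (simp add: set_lebesgue_integral_eq_integral integral_unique algebra_simps)
qed

section \<open>Derivatives of the log-likelihood\<close>

text \<open>The density vanishes there, and \<open>ln 0 = 0\<close> by convention.\<close>

lemma log_likelihood_weibull_nonpos: "x \<le> 0 \<Longrightarrow> log_likelihood weibull_density x = (\<lambda>\<theta>. 0)"
  by (auto simp: log_likelihood_def weibull_density_def)

lemma log_likelihood_weibull:
  assumes "\<theta> \<in> weibull_params" "0 < x"
  shows "log_likelihood weibull_density x \<theta> =
    ln (\<theta> $ 2) - ln (\<theta> $ 1) + (\<theta> $ 2 - 1) * (ln x - ln (\<theta> $ 1)) - (x / \<theta> $ 1) powr \<theta> $ 2"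
  using assms
  by (simp add: log_likelihood_def weibull_density_def weibull_params_def Let_def ln_mult ln_div)

lemma partial_deriv_zero [simp]: "partial_deriv i (\<lambda>\<theta>. 0) = (\<lambda>\<theta>. 0)"
  by (simp add: partial_deriv_def fun_eq_iff)

lemma partial_deriv_eqI:
  fixes f :: "real ^ 'n::finite \<Rightarrow> real"
  assumes "open S" "\<theta> \<in> S" "\<And>\<theta>. \<theta> \<in> S \<Longrightarrow> f \<theta> = g \<theta>"
    and "((\<lambda>t. g (\<theta> + t *\<^sub>R axis i 1)) has_real_derivative d) (at 0)"
  shows "partial_deriv i f \<theta> = d"
  using partial_deriv_cong_open[of S \<theta> f g i, OF assms(1-3)] assms(4)
  by (simp add: partial_deriv_def vector_derivative_at has_real_derivative_iff_has_vector_derivative)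

context
  fixes \<theta> :: "real ^ 2" and x :: real
  assumes \<theta>: "\<theta> \<in> weibull_params" and x: "0 < x"
begin

lemma weibull_score_1:
  "partial_deriv 1 (log_likelihood weibull_density x) \<theta> =
     \<theta> $ 2 / \<theta> $ 1 * ((x / \<theta> $ 1) powr \<theta> $ 2 - 1)"
  by (rule partial_deriv_eqI[OF open_weibull_params \<theta> log_likelihood_weibull[OF _ x]], assumption)
     (use \<theta> x in \<open>auto intro!: derivative_eq_intros simp: weibull_params_def axis_def powr_diff field_simps\<close>)

lemma weibull_score_2:
  "partial_deriv 2 (log_likelihood weibull_density x) \<theta> =
     1 / \<theta> $ 2 + (1 - (x / \<theta> $ 1) powr \<theta> $ 2) * (ln x - ln (\<theta> $ 1))"
  by (rule partial_deriv_eqI[OF open_weibull_params \<theta> log_likelihood_weibull[OF _ x]], assumption)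
     (use \<theta> x in \<open>auto intro!: derivative_eq_intros simp: weibull_params_def axis_def powr_diff field_simps ln_div\<close>)

end

text \<open>A new context is opened so that the score formulas are available for every
  \<open>\<theta>\<close>: second derivatives need them on a neighbourhood.\<close>

context
  fixes \<theta> :: "real ^ 2" and x :: real
  assumes \<theta>: "\<theta> \<in> weibull_params" and x: "0 < x"
begin

lemma weibull_hessian_11:
  "partial_deriv 1 (partial_deriv 1 (log_likelihood weibull_density x)) \<theta> =
     \<theta> $ 2 / (\<theta> $ 1)\<^sup>2 * (1 - (\<theta> $ 2 + 1) * (x / \<theta> $ 1) powr \<theta> $ 2)"
  by (rule partial_deriv_eqI[OF open_weibull_params \<theta> weibull_score_1[OF _ x]], assumption)
     (use \<theta> x in \<open>auto intro!: derivative_eq_intros simp: weibull_params_def axis_def powr_diff field_simps power2_eq_square\<close>)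

text \<open>With \<open>v = (x/a)\<^sup>b\<close>, the identity
  \<open>b * (ln x - ln a) = ln v\<close> makes \<open>x\<close> enter only through \<open>v\<close>
  and leaves \<open>1 / a\<close> as the sole explicit dependence on the parameters.\<close>

lemma weibull_hessian_12:
  "partial_deriv 1 (partial_deriv 2 (log_likelihood weibull_density x)) \<theta> =
     ((x / \<theta> $ 1) powr \<theta> $ 2 * (1 + ln ((x / \<theta> $ 1) powr \<theta> $ 2)) - 1) / \<theta> $ 1"
  by (rule partial_deriv_eqI[OF open_weibull_params \<theta> weibull_score_2[OF _ x]], assumption)
     (use \<theta> x in \<open>auto intro!: derivative_eq_intros simp: weibull_params_def axis_def powr_diff field_simps ln_div\<close>)

lemma weibull_hessian_21:
  "partial_deriv 2 (partial_deriv 1 (log_likelihood weibull_density x)) \<theta> =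
     ((x / \<theta> $ 1) powr \<theta> $ 2 * (1 + ln ((x / \<theta> $ 1) powr \<theta> $ 2)) - 1) / \<theta> $ 1"
  by (rule partial_deriv_eqI[OF open_weibull_params \<theta> weibull_score_1[OF _ x]], assumption)
     (use \<theta> x in \<open>auto intro!: derivative_eq_intros simp: weibull_params_def axis_def powr_diff field_simps ln_div\<close>)

end

section \<open>Entries of the Fisher metric\<close>

lemma fisher_metric_weibull:
  fixes h :: "real \<Rightarrow> real"
  assumes "\<theta> \<in> weibull_params" and "h \<in> borel_measurable borel"
    and "\<And>x. 0 < x \<Longrightarrow> partial_deriv i (partial_deriv j (log_likelihood weibull_density x)) \<theta>
           = h ((x / \<theta> $ 1) powr \<theta> $ 2)"
  shows "fisher_metric weibull_density \<theta> $ i $ j = - (LINT v:{0<..}|lebesgue. exp (- v) * h v)"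
proof -
  have "(\<lambda>x. partial_deriv i (partial_deriv j (log_likelihood weibull_density x)) \<theta>) =
        (\<lambda>x. if 0 < x then h ((x / \<theta> $ 1) powr \<theta> $ 2) else 0)"
    using assms(3) by (auto simp: log_likelihood_weibull_nonpos)
  then show ?thesis
    using weibull_expectation[OF assms(1,2)] by (simp add: fisher_metric_def)
qed

lemma fisher_metric_weibull_11:
  assumes "\<theta> \<in> weibull_params"
  shows "fisher_metric weibull_density \<theta> $ 1 $ 1 = (\<theta> $ 2)\<^sup>2 / (\<theta> $ 1)\<^sup>2"
proof -
  let ?c = "\<theta> $ 2 / (\<theta> $ 1)\<^sup>2"
  have "fisher_metric weibull_density \<theta> $ 1 $ 1 =
      - (LINT v:{0<..}|lebesgue. exp (- v) * (?c + (- ?c * (\<theta> $ 2 + 1)) * v))"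
    by (rule fisher_metric_weibull) (use assms in \<open>auto simp: weibull_hessian_11 right_diff_distrib\<close>)
  also have "\<dots> = (\<theta> $ 2)\<^sup>2 / (\<theta> $ 1)\<^sup>2"
    unfolding exponential_integral_affine by (simp add: ring_distribs power2_eq_square)
  finally show ?thesis .
qed

text \<open>Only the dependence of the mixed entries on \<open>\<theta>\<close> matters below, so the value of the
  integral (one minus the Euler-Mascheroni constant) is left unevaluated.\<close>

definition weibull_mixed :: real where
  "weibull_mixed = - (LINT v:{0<..}|lebesgue. exp (- v) * (v * (1 + ln v) - 1))"

lemma fisher_metric_weibull_mixed:
  assumes "\<theta> \<in> weibull_params"
  shows "fisher_metric weibull_density \<theta> $ 1 $ 2 = weibull_mixed / \<theta> $ 1"
    and "fisher_metric weibull_density \<theta> $ 2 $ 1 = weibull_mixed / \<theta> $ 1"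
proof -
  let ?h = "\<lambda>v. (v * (1 + ln v) - 1) / \<theta> $ 1"
  \<comment> \<open>A constant divisor leaves the integral without an integrability proof.\<close>
  have "- (LINT v:{0<..}|lebesgue. exp (- v) * ?h v) = weibull_mixed / \<theta> $ 1"
    by (simp add: weibull_mixed_def flip: set_integral_divide_zero)
  then show "fisher_metric weibull_density \<theta> $ 1 $ 2 = weibull_mixed / \<theta> $ 1"
    "fisher_metric weibull_density \<theta> $ 2 $ 1 = weibull_mixed / \<theta> $ 1"
    using assms fisher_metric_weibull[OF assms, of ?h 1 2] fisher_metric_weibull[OF assms, of ?h 2 1]
    by (auto simp: weibull_hessian_12 weibull_hessian_21)
qed

theorem proposition3:
  shows "\<not> (\<exists>\<eta>. dual_coordinates weibull_params (fisher_metric weibull_density) \<eta>) \<and>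
         \<not> (\<exists>\<Phi>. potential_function weibull_params (fisher_metric weibull_density) \<Phi>)"
proof (intro conjI notI; elim exE)
  fix \<eta> assume dual: "dual_coordinates weibull_params (fisher_metric weibull_density) \<eta>"
  show False
  proof (rule no_weibull_primitive[where K = weibull_mixed])
    have "\<eta> differentiable_on weibull_params"
      using dual by (simp add: dual_coordinates_def coordinate_system_on_def)
    then show "(\<lambda>\<theta>. \<eta> \<theta> $ 1) differentiable_on weibull_params"
      unfolding differentiable_on_def differentiable_def
      by (blast intro: bounded_linear.has_derivative[OF bounded_linear_vec_nth])
  qed (simp_all add: dual_coordinates_partial_deriv[OF dual open_weibull_params]
        fisher_metric_weibull_11 fisher_metric_weibull_mixed)
next
  fix \<Phi> assume "potential_function weibull_params (fisher_metric weibull_density) \<Phi>"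
  then have "partial_deriv 1 \<Phi> differentiable_on weibull_params"
    and "\<And>\<theta> i. \<theta> \<in> weibull_params \<Longrightarrow>
          partial_deriv i (partial_deriv 1 \<Phi>) \<theta> = fisher_metric weibull_density \<theta> $ i $ 1"
    unfolding potential_function_def by auto
  then show False
    \<comment> \<open>Here the second partial derivative is the entry (2,1), whereas the case of
      dual coordinates uses (1,2).\<close>
    by (intro no_weibull_primitive[of "partial_deriv 1 \<Phi>" weibull_mixed])
       (simp_all add: fisher_metric_weibull_11 fisher_metric_weibull_mixed)
qed

end
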